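(* Let $M$ be a monoid. Let $A$ be an $M$-act defined by a presentation $\langle X\,|\,R\rangle$ (with $X\subseteq A$ a generating set), let $B$ be a subact of $A$ generated by a set $Y\subseteq B$, and let $\langle 0\,|\,S\rangle$ be a presentation for the trivial (one-element) $M$-act $\{0\}$. For each $y\in Y$, choose $w_y\in F_X$ such that $y=w_y$ holds in $A$ (i.e. $w_y$ represents $y$), and let $R'=R\cup\{y=w_y : y\in Y\}$, a set of relations on $F_{X\cup Y}$. Let $L(X,B)$ denote the set of elements of $F_X$ which represent elements of $B$, and define $$R_1=\{(u,v)\in R : u\text{ represents an element of }A\setminus B\},$$ $$R_2=\{u=0 : u\in F_{X\setminus B}\cap L(X,B),\ (u,v)\in\overline{R'}\text{ for some }v\in F_{X\cup Y}\}.$$ Then the Rees quotient $A/B$ is defined by the presentation $\langle (X\setminus B)\cup\{0\}\,|\,R_1\cup R_2\cup S\rangle$, where the generator $0$ stands for the class $B\in A/B$ and each $x\in X\setminus B$ stands for its class $\{x\}$.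
   Context: Let $M$ be a monoid with identity $1$. A (right) $M$-act is a non-empty set $A$ with a map $A\times M\to A$, $(a,m)\mapsto am$, with $a(mn)=(am)n$ and $a1=a$. A subact of $A$ is a non-empty subset $B$ with $bm\in B$ for all $b\in B$, $m\in M$. A subset $U$ generates $A$ if every $a\in A$ is $um$ for some $u\in U$, $m\in M$. A congruence on $A$ is an equivalence relation $\rho$ with $(a,b)\in\rho\Rightarrow(am,bm)\in\rho$ for all $m\in M$. For a set $X$, $F_X=X\times M$ is the free $M$-act with $(x,m)n=(x,mn)$; one writes $x\cdot m$ for $(x,m)$ and $x$ for $(x,1)$. For $X\subseteq Z$ we regard $F_X\subseteq F_Z$. A presentation $\langle X\,|\,R\rangle$ consists of a non-empty set $X$ and a set $R\subseteq F_X\times F_X$ of relations; $(u,v)\in R$ is also written $u=v$. An $M$-act $A$ is defined by $\langle X\,|\,R\rangle$ if $A\cong F_X/\rho$, where $\rho$ is the smallest congruence on $F_X$ containing $R$. The generators $X$ are regarded as elements of $A$ (a generating set), so that $x\cdot m\in F_X$ represents the element $xm\in A$; $R$ then generates the kernel of the homomorphism $F_X\to A$, $x\cdot m\mapsto xm$. For a relation $T$ on a set, $\overline{T}=T\cup\{(u,v):(v,u)\in T\}$. For a subact $B$ of $A$, the Rees quotient $A/B$ is the quotient of $A$ by the congruence $a\,\rho_B\,b\iff a=b$ or $a,b\in B$; the class $B$ is denoted $0$ and the class $\{a\}$ with $a\in A\setminus B$ is identified with $a$. *)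

theory Defs
  imports "HOL-Algebra.Group"
begin

section \<open>Acts over a monoid\<close>

record ('a, 'm) mact = "'a partial_object" +
  act :: "'a \<Rightarrow> 'm \<Rightarrow> 'a"  (infixl "\<cdot>\<index>" 70)

locale right_act = monoid M for M :: "('m, 'k) monoid_scheme" (structure) +
  fixes A :: "('a, 'm) mact"
  assumes nonempty: "carrier A \<noteq> {}"
    and act_closed: "\<lbrakk>a \<in> carrier A; m \<in> carrier M\<rbrakk> \<Longrightarrow> a \<cdot>\<^bsub>A\<^esub> m \<in> carrier A"
    and act_assoc: "\<lbrakk>a \<in> carrier A; m \<in> carrier M; n \<in> carrier M\<rbrakk>
      \<Longrightarrow> a \<cdot>\<^bsub>A\<^esub> (m \<otimes> n) = (a \<cdot>\<^bsub>A\<^esub> m) \<cdot>\<^bsub>A\<^esub> n"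
    and act_one: "a \<in> carrier A \<Longrightarrow> a \<cdot>\<^bsub>A\<^esub> \<one> = a"

definition subact :: "('m, 'k) monoid_scheme \<Rightarrow> ('a, 'm) mact \<Rightarrow> 'a set \<Rightarrow> bool" where
  "subact M A B \<longleftrightarrow>
     B \<noteq> {} \<and> B \<subseteq> carrier A \<and> (\<forall>b\<in>B. \<forall>m\<in>carrier M. b \<cdot>\<^bsub>A\<^esub> m \<in> B)"

definition act_generates :: "('m, 'k) monoid_scheme \<Rightarrow> ('a, 'm) mact \<Rightarrow> 'a set \<Rightarrow> bool" where
  "act_generates M A U \<longleftrightarrow>
     U \<subseteq> carrier A \<and> (\<forall>a\<in>carrier A. \<exists>u\<in>U. \<exists>m\<in>carrier M. a = u \<cdot>\<^bsub>A\<^esub> m)"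

definition act_congruence ::
    "('m, 'k) monoid_scheme \<Rightarrow> ('a, 'm) mact \<Rightarrow> ('a \<times> 'a) set \<Rightarrow> bool" where
  "act_congruence M A \<rho> \<longleftrightarrow>
     equiv (carrier A) \<rho> \<and>
     (\<forall>(a, b)\<in>\<rho>. \<forall>m\<in>carrier M. (a \<cdot>\<^bsub>A\<^esub> m, b \<cdot>\<^bsub>A\<^esub> m) \<in> \<rho>)"

definition generated_congruence ::
    "('m, 'k) monoid_scheme \<Rightarrow> ('a, 'm) mact \<Rightarrow> ('a \<times> 'a) set \<Rightarrow> ('a \<times> 'a) set" where
  "generated_congruence M A R = \<Inter>{\<rho>. act_congruence M A \<rho> \<and> R \<subseteq> \<rho>}"

definition quotient_act :: "('a, 'm) mact \<Rightarrow> ('a \<times> 'a) set \<Rightarrow> ('a set, 'm) mact" where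
  "quotient_act A \<rho> =
     \<lparr>carrier = carrier A // \<rho>, act = (\<lambda>C m. \<Union>c\<in>C. \<rho> `` {c \<cdot>\<^bsub>A\<^esub> m})\<rparr>"

definition act_iso ::
    "('m, 'k) monoid_scheme \<Rightarrow> ('a, 'm) mact \<Rightarrow> ('b, 'm) mact \<Rightarrow> ('a \<Rightarrow> 'b) set" where
  "act_iso M A B = {\<phi>. bij_betw \<phi> (carrier A) (carrier B) \<and>
     (\<forall>a\<in>carrier A. \<forall>m\<in>carrier M. \<phi> (a \<cdot>\<^bsub>A\<^esub> m) = \<phi> a \<cdot>\<^bsub>B\<^esub> m)}"


section \<open>Free acts and presentations\<close>

definition free_act :: "('m, 'k) monoid_scheme \<Rightarrow> 'x set \<Rightarrow> ('x \<times> 'm, 'm) mact" where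
  "free_act M X =
     \<lparr>carrier = X \<times> carrier M, act = (\<lambda>(x, m) n. (x, m \<otimes>\<^bsub>M\<^esub> n))\<rparr>"

definition free_gen :: "('m, 'k) monoid_scheme \<Rightarrow> 'x \<Rightarrow> 'x \<times> 'm" where
  "free_gen M x = (x, \<one>\<^bsub>M\<^esub>)"

definition act_presentation ::
    "('m, 'k) monoid_scheme \<Rightarrow> 'x set \<Rightarrow> (('x \<times> 'm) \<times> ('x \<times> 'm)) set \<Rightarrow> bool" where
  "act_presentation M X R \<longleftrightarrow>
     X \<noteq> {} \<and> R \<subseteq> carrier (free_act M X) \<times> carrier (free_act M X)"

definition presented_act ::
    "('m, 'k) monoid_scheme \<Rightarrow> 'x set \<Rightarrow> (('x \<times> 'm) \<times> ('x \<times> 'm)) set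
     \<Rightarrow> (('x \<times> 'm) set, 'm) mact" where
  "presented_act M X R = quotient_act (free_act M X) (generated_congruence M (free_act M X) R)"

definition defined_by ::
    "('m, 'k) monoid_scheme \<Rightarrow> ('a, 'm) mact \<Rightarrow> 'x set \<Rightarrow> (('x \<times> 'm) \<times> ('x \<times> 'm)) set
     \<Rightarrow> bool" where
  "defined_by M A X R \<longleftrightarrow>
     right_act M A \<and> act_presentation M X R \<and> (\<exists>\<phi>. \<phi> \<in> act_iso M (presented_act M X R) A)"

text \<open>In \<open>defined_by_via\<close> the function \<open>\<iota>\<close> records which element of \<open>A\<close> each generator stands
  for; \<open>\<iota> = id\<close> when the generators are themselves elements of \<open>A\<close>.\<close>

definition defined_by_via ::
    "('m, 'k) monoid_scheme \<Rightarrow> ('a, 'm) mact \<Rightarrow> 'x set \<Rightarrow> (('x \<times> 'm) \<times> ('x \<times> 'm)) set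
     \<Rightarrow> ('x \<Rightarrow> 'a) \<Rightarrow> bool" where
  "defined_by_via M A X R \<iota> \<longleftrightarrow>
     right_act M A \<and> act_presentation M X R \<and>
     (\<exists>\<phi> \<in> act_iso M (presented_act M X R) A. \<forall>x\<in>X.
        \<phi> (generated_congruence M (free_act M X) R `` {free_gen M x}) = \<iota> x)"

definition represents :: "('a, 'm) mact \<Rightarrow> 'a \<times> 'm \<Rightarrow> 'a \<Rightarrow> bool" where
  "represents A u a \<longleftrightarrow> fst u \<cdot>\<^bsub>A\<^esub> snd u = a"


section \<open>Rees quotients\<close>

definition trivial_act :: "'a \<Rightarrow> ('a, 'm) mact" where
  "trivial_act z = \<lparr>carrier = {z}, act = (\<lambda>_ _. z)\<rparr>"

definition rees_congruence :: "('a, 'm) mact \<Rightarrow> 'a set \<Rightarrow> ('a \<times> 'a) set" where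
  "rees_congruence A B =
     {(a, b). a \<in> carrier A \<and> b \<in> carrier A \<and> (a = b \<or> a \<in> B \<and> b \<in> B)}"

definition rees_quotient :: "('a, 'm) mact \<Rightarrow> 'a set \<Rightarrow> ('a set, 'm) mact" where
  "rees_quotient A B = quotient_act A (rees_congruence A B)"


section \<open>The relations presenting a Rees quotient\<close>

text \<open>The generating set \<open>(X - B) \<union> {0}\<close> is encoded in the option type: \<open>None\<close> is the new
  generator \<open>0\<close>, and \<open>Some x\<close> is \<open>x\<close>. Accordingly \<open>lift_word\<close> regards elements of
  the free act on \<open>X\<close> as elements of the free act on a set containing \<open>Some ` X\<close>.\<close>

definition zero_gens :: "'a set \<Rightarrow> 'a set \<Rightarrow> 'a option set" where
  "zero_gens X B = Some ` (X - B) \<union> {None}"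

definition lift_word :: "'a \<times> 'm \<Rightarrow> 'a option \<times> 'm" where
  "lift_word = map_prod Some id"

definition L_words ::
    "('m, 'k) monoid_scheme \<Rightarrow> ('a, 'm) mact \<Rightarrow> 'a set \<Rightarrow> 'a set \<Rightarrow> ('a \<times> 'm) set" where
  "L_words M A X B = {u \<in> carrier (free_act M X). \<exists>b\<in>B. represents A u b}"

definition R_ext ::
    "('m, 'k) monoid_scheme \<Rightarrow> (('a \<times> 'm) \<times> ('a \<times> 'm)) set \<Rightarrow> 'a set \<Rightarrow> ('a \<Rightarrow> 'a \<times> 'm)
     \<Rightarrow> (('a \<times> 'm) \<times> ('a \<times> 'm)) set" where
  "R_ext M R Y w = R \<union> {(free_gen M y, w y) | y. y \<in> Y}"

definition R_one ::
    "('a, 'm) mact \<Rightarrow> 'a set \<Rightarrow> (('a \<times> 'm) \<times> ('a \<times> 'm)) set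
     \<Rightarrow> (('a option \<times> 'm) \<times> ('a option \<times> 'm)) set" where
  "R_one A B R =
     {(lift_word u, lift_word v) | u v. (u, v) \<in> R \<and> (\<exists>a\<in>carrier A - B. represents A u a)}"

definition R_two ::
    "('m, 'k) monoid_scheme \<Rightarrow> ('a, 'm) mact \<Rightarrow> 'a set \<Rightarrow> 'a set \<Rightarrow> 'a set
     \<Rightarrow> (('a \<times> 'm) \<times> ('a \<times> 'm)) set \<Rightarrow> ('a \<Rightarrow> 'a \<times> 'm)
     \<Rightarrow> (('a option \<times> 'm) \<times> ('a option \<times> 'm)) set" where
  "R_two M A X B Y R w =
     {(lift_word u, free_gen M None) | u.
        u \<in> carrier (free_act M (X - B)) \<inter> L_words M A X B \<and>
        (\<exists>v\<in>carrier (free_act M (X \<union> Y)). (u, v) \<in> R_ext M R Y w \<union> (R_ext M R Y w)\<inverse>)}"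

end

theory Submission
  imports Defs
begin

text \<open>Let \<open>\<rho>\<close> and \<open>\<tau>\<close> be the congruences generated by \<open>R\<close> and by \<open>R\<^sub>1 \<union> R\<^sub>2 \<union> S\<close>. The map of
  words that sends \<open>x \<cdot> m\<close> to itself if \<open>x \<notin> B\<close> and to \<open>0\<close> if \<open>x \<in> B\<close> is an act homomorphism
  modulo \<open>\<tau>\<close> because \<open>S\<close> identifies all \<open>0 \<cdot> m\<close>, and it sends the relations in \<open>R\<close> into \<open>\<tau>\<close>;
  hence it carries \<open>\<rho>\<close> into \<open>\<tau>\<close>. A word representing \<open>b = yn \<in> B\<close> is \<open>\<rho>\<close>-related to
  \<open>w\<^sub>y \<cdot> n\<close>, whose image is \<open>\<tau>\<close>-related to \<open>0\<close> by \<open>R\<^sub>2\<close>. So \<open>\<tau>\<close> contains, and therefore equals,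
  the kernel of the evaluation of words in \<open>A/B\<close>.\<close>

section \<open>Congruences and quotients of acts\<close>

lemma act_congruence_closed:
  "act_congruence M A \<rho> \<Longrightarrow> (a, b) \<in> \<rho> \<Longrightarrow> a \<in> carrier A \<and> b \<in> carrier A"
  unfolding act_congruence_def by (auto dest: equiv_type)

lemma act_congruence_refl: "act_congruence M A \<rho> \<Longrightarrow> a \<in> carrier A \<Longrightarrow> (a, a) \<in> \<rho>"
  unfolding act_congruence_def by (blast elim: equivE dest: refl_onD)

lemma act_congruence_sym: "act_congruence M A \<rho> \<Longrightarrow> (a, b) \<in> \<rho> \<Longrightarrow> (b, a) \<in> \<rho>"
  unfolding act_congruence_def by (blast elim: equivE dest: symD)

lemma act_congruence_trans:
  "act_congruence M A \<rho> \<Longrightarrow> (a, b) \<in> \<rho> \<Longrightarrow> (b, c) \<in> \<rho> \<Longrightarrow> (a, c) \<in> \<rho>"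
  unfolding act_congruence_def by (blast elim: equivE dest: transD)

lemma act_congruence_act:
  "act_congruence M A \<rho> \<Longrightarrow> (a, b) \<in> \<rho> \<Longrightarrow> m \<in> carrier M
    \<Longrightarrow> (a \<cdot>\<^bsub>A\<^esub> m, b \<cdot>\<^bsub>A\<^esub> m) \<in> \<rho>"
  unfolding act_congruence_def by auto

lemma act_congruenceI:
  assumes "\<And>a b. (a, b) \<in> \<rho> \<Longrightarrow> a \<in> carrier A \<and> b \<in> carrier A"
    and "\<And>a. a \<in> carrier A \<Longrightarrow> (a, a) \<in> \<rho>"
    and "\<And>a b. (a, b) \<in> \<rho> \<Longrightarrow> (b, a) \<in> \<rho>"
    and "\<And>a b c. (a, b) \<in> \<rho> \<Longrightarrow> (b, c) \<in> \<rho> \<Longrightarrow> (a, c) \<in> \<rho>"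
    and "\<And>a b m. (a, b) \<in> \<rho> \<Longrightarrow> m \<in> carrier M \<Longrightarrow> (a \<cdot>\<^bsub>A\<^esub> m, b \<cdot>\<^bsub>A\<^esub> m) \<in> \<rho>"
  shows "act_congruence M A \<rho>"
proof -
  have "equiv (carrier A) \<rho>"
  proof (rule equivI)
    show "\<rho> \<subseteq> carrier A \<times> carrier A" using assms(1) by auto
    show "refl_on (carrier A) \<rho>" by (rule refl_onI) (rule assms(2))
    show "sym \<rho>" by (rule symI) (rule assms(3))
    show "trans \<rho>" by (rule transI) (rule assms(4))
  qed
  then show ?thesis unfolding act_congruence_def using assms(5) by auto
qed

lemma act_congruence_class_eq_iff:
  assumes "act_congruence M A \<rho>" "a \<in> carrier A" "b \<in> carrier A"
  shows "\<rho> `` {a} = \<rho> `` {b} \<longleftrightarrow> (a, b) \<in> \<rho>"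
  using assms eq_equiv_class_iff[of "carrier A" \<rho> a b] unfolding act_congruence_def by simp

text \<open>Asking \<open>f\<close> to be a homomorphism only modulo \<tau> is enough: followed by
  the projection of \<open>C\<close> modulo \<tau> it is a genuine homomorphism, and the relation
  here is the kernel of that composite. The map of words used for the Rees quotient commutes with
  the action only in this weak sense.\<close>

lemma act_congruence_pullback:
  assumes "right_act M A" and \<tau>: "act_congruence M C \<tau>"
    and f: "\<And>a. a \<in> carrier A \<Longrightarrow> f a \<in> carrier C"
    and hom: "\<And>a m. a \<in> carrier A \<Longrightarrow> m \<in> carrier M \<Longrightarrow> (f (a \<cdot>\<^bsub>A\<^esub> m), f a \<cdot>\<^bsub>C\<^esub> m) \<in> \<tau>"
  shows "act_congruence M A {(a, b). a \<in> carrier A \<and> b \<in> carrier A \<and> (f a, f b) \<in> \<tau>}"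
proof (rule act_congruenceI, goal_cases)
  case (2 a)
  then show ?case using f act_congruence_refl[OF \<tau>] by simp
next
  case (3 a b)
  then show ?case using act_congruence_sym[OF \<tau>] by simp
next
  case (4 a b c)
  then show ?case using act_congruence_trans[OF \<tau>, of "f a" "f b" "f c"] by simp
next
  case (5 a b m)
  then have "(f (a \<cdot>\<^bsub>A\<^esub> m), f b \<cdot>\<^bsub>C\<^esub> m) \<in> \<tau>"
    using act_congruence_trans[OF \<tau> hom act_congruence_act[OF \<tau>]] by simp
  moreover have "(f b \<cdot>\<^bsub>C\<^esub> m, f (b \<cdot>\<^bsub>A\<^esub> m)) \<in> \<tau>"
    using 5 act_congruence_sym[OF \<tau> hom] by simp
  ultimately have "(f (a \<cdot>\<^bsub>A\<^esub> m), f (b \<cdot>\<^bsub>A\<^esub> m)) \<in> \<tau>"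
    by (rule act_congruence_trans[OF \<tau>])
  with 5 show ?case using right_act.act_closed[OF assms(1)] by simp
qed simp

lemma act_congruence_equality: "right_act M A \<Longrightarrow> act_congruence M A (Id_on (carrier A))"
  by (rule act_congruenceI) (auto intro: right_act.act_closed)

lemma generated_congruence_superset: "R \<subseteq> generated_congruence M A R"
  unfolding generated_congruence_def by blast

lemma generated_congruence_least:
  "act_congruence M A \<rho> \<Longrightarrow> R \<subseteq> \<rho> \<Longrightarrow> generated_congruence M A R \<subseteq> \<rho>"
  unfolding generated_congruence_def by blast

lemma act_congruence_generated:
  assumes "right_act M A" "R \<subseteq> carrier A \<times> carrier A"
  shows "act_congruence M A (generated_congruence M A R)"
proof -
  \<comment> \<open>The total relation is a member of the intersected family. It confines the
    intersection to the carrier; an empty family would give the universal relation of the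
    type.\<close>
  have univ: "act_congruence M A (carrier A \<times> carrier A)"
    by (rule act_congruenceI) (auto intro: right_act.act_closed[OF assms(1)])
  show ?thesis
  proof (rule act_congruenceI, goal_cases)
    case (1 a b)
    then show ?case using generated_congruence_least[OF univ assms(2)] by blast
  next
    case 2
    then show ?case unfolding generated_congruence_def by (auto intro: act_congruence_refl)
  next
    case 3
    then show ?case unfolding generated_congruence_def by (auto intro: act_congruence_sym)
  next
    case 4
    then show ?case unfolding generated_congruence_def by (blast intro: act_congruence_trans)
  next
    case 5
    then show ?case unfolding generated_congruence_def by (auto intro: act_congruence_act)
  qed
qed

text \<open>The pullback of \<tau> along \<open>f\<close> is a congruence containing
  \<open>R\<close>, so it contains the generated one. This takes the place of an induction along
  chains of elementary \<open>R\<close>-steps. It serves for three maps: an inclusion of free acts,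
  the map of words \<open>f\<close>, and evaluation in the Rees quotient.\<close>

lemma generated_congruence_map:
  assumes "right_act M A" "act_congruence M C \<tau>"
    and "\<And>a. a \<in> carrier A \<Longrightarrow> f a \<in> carrier C"
    and "\<And>a m. a \<in> carrier A \<Longrightarrow> m \<in> carrier M \<Longrightarrow> (f (a \<cdot>\<^bsub>A\<^esub> m), f a \<cdot>\<^bsub>C\<^esub> m) \<in> \<tau>"
    and "R \<subseteq> carrier A \<times> carrier A" "\<And>a b. (a, b) \<in> R \<Longrightarrow> (f a, f b) \<in> \<tau>"
    and "(a, b) \<in> generated_congruence M A R"
  shows "(f a, f b) \<in> \<tau>"
proof -
  have "generated_congruence M A R
      \<subseteq> {(a, b). a \<in> carrier A \<and> b \<in> carrier A \<and> (f a, f b) \<in> \<tau>}"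
    by (rule generated_congruence_least[OF act_congruence_pullback]) (use assms in auto)
  with assms(7) show ?thesis by auto
qed

lemma carrier_quotient_act: "carrier (quotient_act A \<rho>) = (\<lambda>a. \<rho> `` {a}) ` carrier A"
  by (auto simp: quotient_act_def quotient_def)

text \<open>The union in \<open>quotient_act\<close> runs over all members of the class instead of
  choosing one. It collapses to a single class because congruent elements stay congruent under the
  action.\<close>

lemma act_quotient_class:
  assumes A: "right_act M A" and \<rho>: "act_congruence M A \<rho>"
    and "a \<in> carrier A" "m \<in> carrier M"
  shows "(\<rho> `` {a}) \<cdot>\<^bsub>quotient_act A \<rho>\<^esub> m = \<rho> `` {a \<cdot>\<^bsub>A\<^esub> m}"
proof -
  have "\<rho> `` {a} \<noteq> {}"
    using act_congruence_refl[OF \<rho>] assms(3) by blast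
  moreover have "\<rho> `` {c \<cdot>\<^bsub>A\<^esub> m} = \<rho> `` {a \<cdot>\<^bsub>A\<^esub> m}" if "c \<in> \<rho> `` {a}" for c
    using that assms act_congruence_class_eq_iff[OF \<rho>] act_congruence_act[OF \<rho>]
      act_congruence_closed[OF \<rho>] act_congruence_sym[OF \<rho>] right_act.act_closed[OF A]
    by (metis Image_singleton_iff)
  ultimately have "(\<Union>c\<in>\<rho> `` {a}. \<rho> `` {c \<cdot>\<^bsub>A\<^esub> m}) = \<rho> `` {a \<cdot>\<^bsub>A\<^esub> m}"
    by (rule SUP_eq_const)
  then show ?thesis by (simp add: quotient_act_def)
qed

lemma right_act_quotient:
  assumes A: "right_act M A" and \<rho>: "act_congruence M A \<rho>"
  shows "right_act M (quotient_act A \<rho>)"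
proof -
  interpret right_act M A by fact
  note act = act_quotient_class[OF A \<rho>]
  show ?thesis
  proof
    show "carrier (quotient_act A \<rho>) \<noteq> {}"
      using nonempty by (simp add: carrier_quotient_act)
  next
    fix C m n assume "C \<in> carrier (quotient_act A \<rho>)" and m: "m \<in> carrier M"
    then obtain a where a: "a \<in> carrier A" "C = \<rho> `` {a}"
      unfolding carrier_quotient_act by blast
    with m show "C \<cdot>\<^bsub>quotient_act A \<rho>\<^esub> m \<in> carrier (quotient_act A \<rho>)"
      unfolding carrier_quotient_act using act act_closed by simp
    assume n: "n \<in> carrier M"
    show "C \<cdot>\<^bsub>quotient_act A \<rho>\<^esub> (m \<otimes>\<^bsub>M\<^esub> n)
        = C \<cdot>\<^bsub>quotient_act A \<rho>\<^esub> m \<cdot>\<^bsub>quotient_act A \<rho>\<^esub> n"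
      using a m n by (simp add: act act_closed act_assoc)
  next
    fix C assume "C \<in> carrier (quotient_act A \<rho>)"
    then show "C \<cdot>\<^bsub>quotient_act A \<rho>\<^esub> \<one>\<^bsub>M\<^esub> = C"
      unfolding carrier_quotient_act by (auto simp only: act one_closed act_one)
  qed
qed

section \<open>Presentations\<close>

lemma carrier_free_act: "carrier (free_act M X) = X \<times> carrier M"
  by (simp add: free_act_def)

lemma act_free_act: "(x, m) \<cdot>\<^bsub>free_act M X\<^esub> n = (x, m \<otimes>\<^bsub>M\<^esub> n)"
  by (simp add: free_act_def)

lemma right_act_free:
  assumes "monoid M" "X \<noteq> {}"
  shows "right_act M (free_act M X)"
proof -
  interpret monoid M by fact
  show ?thesis
    by unfold_locales (use assms(2) in \<open>auto simp: carrier_free_act act_free_act m_assoc\<close>)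
qed

text \<open>If \<iota> maps the generators into an act \<open>A\<close>, this is the homomorphism
  from the free act to \<open>A\<close> that extends \<iota>.\<close>

definition eval_word :: "('a, 'm) mact \<Rightarrow> ('x \<Rightarrow> 'a) \<Rightarrow> 'x \<times> 'm \<Rightarrow> 'a" where
  "eval_word A \<iota> u = \<iota> (fst u) \<cdot>\<^bsub>A\<^esub> snd u"

lemma act_presentationD:
  assumes "monoid M" "act_presentation M X R"
  shows "right_act M (free_act M X)"
    and "act_congruence M (free_act M X) (generated_congruence M (free_act M X) R)"
proof -
  have "X \<noteq> {}" and R: "R \<subseteq> carrier (free_act M X) \<times> carrier (free_act M X)"
    using assms(2) unfolding act_presentation_def by auto
  from right_act_free[OF assms(1) this(1)] show F: "right_act M (free_act M X)" .
  show "act_congruence M (free_act M X) (generated_congruence M (free_act M X) R)"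
    by (rule act_congruence_generated[OF F R])
qed

text \<open>The isomorphism \<phi> composed with the projection of the free act is a homomorphism
  agreeing with \<iota> on generators, hence is evaluation. Injectivity of \<phi> then identifies
  the kernel.\<close>

lemma defined_by_via_kernel:
  assumes "defined_by_via M A X R \<iota>"
    and u: "u \<in> carrier (free_act M X)" and v: "v \<in> carrier (free_act M X)"
  shows "(u, v) \<in> generated_congruence M (free_act M X) R
    \<longleftrightarrow> eval_word A \<iota> u = eval_word A \<iota> v"
proof -
  let ?F = "free_act M X"
  let ?\<rho> = "generated_congruence M ?F R"
  from assms(1) obtain \<phi> where A: "right_act M A" and pres: "act_presentation M X R"
    and \<phi>: "\<phi> \<in> act_iso M (quotient_act ?F ?\<rho>) A"
    and \<phi>_gen: "\<And>x. x \<in> X \<Longrightarrow> \<phi> (?\<rho> `` {free_gen M x}) = \<iota> x"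
    unfolding defined_by_via_def presented_act_def by blast
  interpret right_act M A by fact
  note F = act_presentationD[OF monoid_axioms pres]
  have \<phi>_eval: "\<phi> (?\<rho> `` {u}) = eval_word A \<iota> u" if "u \<in> carrier ?F" for u
  proof -
    obtain x m where xm: "u = (x, m)" "x \<in> X" "m \<in> carrier M"
      using \<open>u \<in> carrier ?F\<close> by (auto simp: carrier_free_act)
    have gen: "free_gen M x \<in> carrier ?F"
      using xm by (simp add: free_gen_def carrier_free_act)
    have "?\<rho> `` {u} = (?\<rho> `` {free_gen M x}) \<cdot>\<^bsub>quotient_act ?F ?\<rho>\<^esub> m"
      using act_quotient_class[OF F gen xm(3)] xm by (simp add: free_gen_def act_free_act)
    moreover have "?\<rho> `` {free_gen M x} \<in> carrier (quotient_act ?F ?\<rho>)"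
      using gen by (simp add: carrier_quotient_act)
    then have "\<phi> ((?\<rho> `` {free_gen M x}) \<cdot>\<^bsub>quotient_act ?F ?\<rho>\<^esub> m)
        = \<phi> (?\<rho> `` {free_gen M x}) \<cdot>\<^bsub>A\<^esub> m"
      using \<phi> xm(3) unfolding act_iso_def by blast
    ultimately show ?thesis
      using \<phi>_gen[OF xm(2)] xm(1) by (simp add: eval_word_def)
  qed
  have "inj_on \<phi> ((\<lambda>u. ?\<rho> `` {u}) ` carrier ?F)"
    using \<phi> unfolding act_iso_def bij_betw_def by (simp add: carrier_quotient_act)
  then have "\<phi> (?\<rho> `` {u}) = \<phi> (?\<rho> `` {v}) \<longleftrightarrow> ?\<rho> `` {u} = ?\<rho> `` {v}"
    by (rule inj_on_eq_iff) (use u v in blast)+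
  then show ?thesis
    using act_congruence_class_eq_iff[OF F(2) u v] \<phi>_eval u v by simp
qed

text \<open>The first isomorphism theorem for acts: evaluation is onto because \<iota> hits a
  generating set, and it is injective on classes by the assumption on its kernel.\<close>

lemma defined_by_viaI:
  assumes A: "right_act M A" and pres: "act_presentation M X R"
    and gen: "act_generates M A (\<iota> ` X)"
    and ker: "\<And>u v. u \<in> carrier (free_act M X) \<Longrightarrow> v \<in> carrier (free_act M X) \<Longrightarrow>
      (u, v) \<in> generated_congruence M (free_act M X) R \<longleftrightarrow> eval_word A \<iota> u = eval_word A \<iota> v"
  shows "defined_by_via M A X R \<iota>"
proof -
  interpret right_act M A by fact
  let ?F = "free_act M X"
  let ?\<rho> = "generated_congruence M ?F R"
  let ?e = "eval_word A \<iota>"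
  note F = act_presentationD[OF monoid_axioms pres]
  \<comment> \<open>The representative is arbitrary; by \<open>ker\<close> evaluation is constant on
    each class.\<close>
  define \<phi> where "\<phi> C = ?e (SOME u. u \<in> C)" for C
  have \<phi>_class: "\<phi> (?\<rho> `` {u}) = ?e u" if "u \<in> carrier ?F" for u
  proof -
    have "u \<in> ?\<rho> `` {u}" using act_congruence_refl[OF F(2)] that by blast
    then have "(SOME v. v \<in> ?\<rho> `` {u}) \<in> ?\<rho> `` {u}" by (rule someI)
    then show ?thesis
      unfolding \<phi>_def using ker act_congruence_closed[OF F(2)] by fastforce
  qed
  have \<iota>: "\<iota> x \<in> carrier A" if "x \<in> X" for x
    using gen that unfolding act_generates_def by blast
  have image: "?e ` carrier ?F = carrier A"
  proof
    show "?e ` carrier ?F \<subseteq> carrier A"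
      using \<iota> act_closed by (auto simp: carrier_free_act eval_word_def)
    show "carrier A \<subseteq> ?e ` carrier ?F"
      using gen unfolding act_generates_def
      by (fastforce simp: carrier_free_act eval_word_def image_iff)
  qed
  have "bij_betw \<phi> (carrier (quotient_act ?F ?\<rho>)) (carrier A)"
    unfolding bij_betw_def
  proof
    show "inj_on \<phi> (carrier (quotient_act ?F ?\<rho>))"
    proof (rule inj_onI)
      fix C D
      assume "C \<in> carrier (quotient_act ?F ?\<rho>)" "D \<in> carrier (quotient_act ?F ?\<rho>)" "\<phi> C = \<phi> D"
      moreover from this(1,2) obtain u v where uv: "u \<in> carrier ?F" "v \<in> carrier ?F"
        "C = ?\<rho> `` {u}" "D = ?\<rho> `` {v}"
        unfolding carrier_quotient_act by blast
      ultimately have "?e u = ?e v" using \<phi>_class by simp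
      then show "C = D"
        using uv ker act_congruence_class_eq_iff[OF F(2)] by simp
    qed
    have "\<phi> ` carrier (quotient_act ?F ?\<rho>) = (\<lambda>u. \<phi> (?\<rho> `` {u})) ` carrier ?F"
      unfolding carrier_quotient_act by (rule image_image)
    also have "\<dots> = ?e ` carrier ?F"
      by (rule image_cong[OF refl \<phi>_class])
    finally show "\<phi> ` carrier (quotient_act ?F ?\<rho>) = carrier A"
      using image by simp
  qed
  moreover have "\<phi> (C \<cdot>\<^bsub>quotient_act ?F ?\<rho>\<^esub> m) = \<phi> C \<cdot>\<^bsub>A\<^esub> m"
    if C: "C \<in> carrier (quotient_act ?F ?\<rho>)" and m: "m \<in> carrier M" for C m
  proof -
    obtain u where u: "C = ?\<rho> `` {u}" "u \<in> carrier ?F"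
      using C unfolding carrier_quotient_act by blast
    then have "\<phi> (C \<cdot>\<^bsub>quotient_act ?F ?\<rho>\<^esub> m) = ?e (u \<cdot>\<^bsub>?F\<^esub> m)"
      using act_quotient_class[OF F u(2) m] \<phi>_class right_act.act_closed[OF F(1) u(2) m] by simp
    also have "\<dots> = ?e u \<cdot>\<^bsub>A\<^esub> m"
      using u(2) m \<iota> act_assoc by (auto simp: carrier_free_act act_free_act eval_word_def)
    finally show ?thesis using u \<phi>_class by simp
  qed
  ultimately have "\<phi> \<in> act_iso M (presented_act M X R) A"
    by (simp add: act_iso_def presented_act_def)
  moreover have "\<phi> (?\<rho> `` {free_gen M x}) = \<iota> x" if "x \<in> X" for x
    using that \<iota> by (simp add: \<phi>_class carrier_free_act free_gen_def eval_word_def act_one)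
  ultimately show ?thesis
    using A pres unfolding defined_by_via_def by blast
qed

text \<open>With only one possible value, the isomorphism necessarily sends every generator to
  \<open>z\<close>. So the kernel criterion applies, and evaluation is constant.\<close>

lemma defined_by_trivial_act:
  fixes z :: 'a and M :: "('m, 'k) monoid_scheme"
  assumes "defined_by M (trivial_act z) X S"
    and "u \<in> carrier (free_act M X)" "v \<in> carrier (free_act M X)"
  shows "(u, v) \<in> generated_congruence M (free_act M X) S"
proof -
  obtain \<phi> where A: "right_act M (trivial_act z :: ('a, 'm) mact)" and pres: "act_presentation M X S"
    and \<phi>: "\<phi> \<in> act_iso M (presented_act M X S) (trivial_act z)"
    using assms(1) unfolding defined_by_def by blast
  interpret right_act M "trivial_act z :: ('a, 'm) mact" by fact
  have "\<phi> (generated_congruence M (free_act M X) S `` {free_gen M x}) = z" if "x \<in> X" for x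
  proof -
    have "generated_congruence M (free_act M X) S `` {free_gen M x}
        \<in> carrier (presented_act M X S)"
      unfolding presented_act_def carrier_quotient_act
      by (rule imageI) (use that in \<open>simp add: carrier_free_act free_gen_def\<close>)
    then have "\<phi> (generated_congruence M (free_act M X) S `` {free_gen M x})
        \<in> carrier (trivial_act z :: ('a, 'm) mact)"
      using \<phi> unfolding act_iso_def by (auto dest: bij_betwE)
    then show ?thesis by (simp add: trivial_act_def)
  qed
  then have "defined_by_via M (trivial_act z) X S (\<lambda>_. z)"
    unfolding defined_by_via_def using A pres \<phi> by blast
  from defined_by_via_kernel[OF this assms(2,3)] show ?thesis
    by (simp add: eval_word_def trivial_act_def)
qed

section \<open>Rees quotients\<close>

lemma subact_closed:
  "subact M A B \<Longrightarrow> b \<in> B \<Longrightarrow> m \<in> carrier M \<Longrightarrow> b \<cdot>\<^bsub>A\<^esub> m \<in> B"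
  unfolding subact_def by blast

lemma act_congruence_rees:
  assumes "right_act M A" "subact M A B"
  shows "act_congruence M A (rees_congruence A B)"
  by (rule act_congruenceI)
    (auto simp: rees_congruence_def right_act.act_closed[OF assms(1)] subact_closed[OF assms(2)])

lemma rees_class:
  assumes "subact M A B" "a \<in> carrier A"
  shows "rees_congruence A B `` {a} = (if a \<in> B then B else {a})"
  using assms unfolding subact_def rees_congruence_def by auto

lemma act_rees_quotient:
  assumes "right_act M A" "subact M A B"
  shows "a \<in> carrier A - B \<Longrightarrow> m \<in> carrier M \<Longrightarrow>
      {a} \<cdot>\<^bsub>rees_quotient A B\<^esub> m = (if a \<cdot>\<^bsub>A\<^esub> m \<in> B then B else {a \<cdot>\<^bsub>A\<^esub> m})"
    and "m \<in> carrier M \<Longrightarrow> B \<cdot>\<^bsub>rees_quotient A B\<^esub> m = B"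
proof -
  note act = act_quotient_class[OF assms(1) act_congruence_rees[OF assms]]
  note closed = right_act.act_closed[OF assms(1)]
  show "{a} \<cdot>\<^bsub>rees_quotient A B\<^esub> m = (if a \<cdot>\<^bsub>A\<^esub> m \<in> B then B else {a \<cdot>\<^bsub>A\<^esub> m})"
    if "a \<in> carrier A - B" "m \<in> carrier M"
    using act[of a m] that rees_class[OF assms(2)] closed by (auto simp: rees_quotient_def)
  obtain b where b: "b \<in> B" "b \<in> carrier A" using assms(2) unfolding subact_def by blast
  show "B \<cdot>\<^bsub>rees_quotient A B\<^esub> m = B" if "m \<in> carrier M"
    using act[of b m] that b rees_class[OF assms(2)] closed subact_closed[OF assms(2)]
    by (auto simp: rees_quotient_def)
qed

theorem theorem4p1:
  fixes M :: "('m, 'k) monoid_scheme"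
    and A :: "('a, 'm) mact"
    and X B Y :: "'a set"
    and R :: "(('a \<times> 'm) \<times> ('a \<times> 'm)) set"
    and S :: "(('a option \<times> 'm) \<times> ('a option \<times> 'm)) set"
    and w :: "'a \<Rightarrow> 'a \<times> 'm"
  assumes "monoid M"
    and "right_act M A"
    and "act_generates M A X"
    and "defined_by_via M A X R id"
    and "subact M A B"
    and "act_generates M (A\<lparr>carrier := B\<rparr>) Y"
    and "defined_by M (trivial_act (None :: 'a option)) {None :: 'a option} S"
    and "\<forall>y\<in>Y. w y \<in> carrier (free_act M X) \<and> represents A (w y) y"
  shows "defined_by_via M (rees_quotient A B) (zero_gens X B)
           (R_one A B R \<union> R_two M A X B Y R w \<union> S)
           (case_option B (\<lambda>x. {x}))"
proof -
  interpret right_act M A by fact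
  let ?Z = "zero_gens X B"
  let ?F = "free_act M X"
  let ?G = "free_act M ?Z"
  let ?T = "R_one A B R \<union> R_two M A X B Y R w \<union> S"
  let ?\<rho> = "generated_congruence M ?F R"
  let ?\<tau> = "generated_congruence M ?G ?T"
  let ?Q = "rees_quotient A B"
  let ?\<iota> = "case_option B (\<lambda>x. {x})"
  let ?zero = "free_gen M (None :: 'a option)"

  \<comment> \<open>The relations on the new generators\<close>
  have XA: "X \<subseteq> carrier A" using assms(3) unfolding act_generates_def by blast
  have BA: "B \<subseteq> carrier A" using assms(5) unfolding subact_def by blast
  have presR: "act_presentation M X R"
    using assms(4) unfolding defined_by_via_def by blast
  then have RF: "R \<subseteq> carrier ?F \<times> carrier ?F" unfolding act_presentation_def by blast
  have presS: "act_presentation M {None} S"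
    using assms(7) unfolding defined_by_def by blast
  note F = act_presentationD[OF assms(1) presR]
  have ker_R: "(u, v) \<in> ?\<rho> \<longleftrightarrow> fst u \<cdot>\<^bsub>A\<^esub> snd u = fst v \<cdot>\<^bsub>A\<^esub> snd v"
    if "u \<in> carrier ?F" "v \<in> carrier ?F" for u v
    using defined_by_via_kernel[OF assms(4) that] by (simp add: eval_word_def)
  have R_eq: "x \<cdot>\<^bsub>A\<^esub> m = y \<cdot>\<^bsub>A\<^esub> n"
    and R_car: "x \<in> X" "m \<in> carrier M" "y \<in> X" "n \<in> carrier M"
    if "((x, m), (y, n)) \<in> R" for x m y n
    using that ker_R[of "(x, m)" "(y, n)"] RF generated_congruence_superset[of R M ?F]
    by (auto simp: carrier_free_act)
  have R_one_car: "R_one A B R \<subseteq> carrier ?G \<times> carrier ?G"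
  proof
    fix p assume "p \<in> R_one A B R"
    then obtain x m y n where p: "p = (lift_word (x, m), lift_word (y, n))"
      "((x, m), (y, n)) \<in> R" "x \<cdot>\<^bsub>A\<^esub> m \<notin> B"
      unfolding R_one_def represents_def by auto
    \<comment> \<open>\<open>R_one\<close> restricts only the left word, but by \<open>R_eq\<close>
      the right word represents the same element outside \<open>B\<close>. A generator in
      \<open>B\<close> would keep the whole word in \<open>B\<close>.\<close>
    moreover have "x \<notin> B" "y \<notin> B"
      using p R_car[OF p(2)] R_eq[OF p(2)] subact_closed[OF assms(5)] by metis+
    ultimately show "p \<in> carrier ?G \<times> carrier ?G"
      using R_car[OF p(2)] by (auto simp: carrier_free_act zero_gens_def lift_word_def)
  qed
  moreover have "R_two M A X B Y R w \<subseteq> carrier ?G \<times> carrier ?G"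
    by (auto simp: R_two_def carrier_free_act zero_gens_def lift_word_def free_gen_def)
  moreover have "S \<subseteq> carrier ?G \<times> carrier ?G"
    using presS by (auto simp: act_presentation_def carrier_free_act zero_gens_def)
  ultimately have TG: "?T \<subseteq> carrier ?G \<times> carrier ?G" by blast
  then have presT: "act_presentation M ?Z ?T"
    unfolding act_presentation_def zero_gens_def by blast
  note G = act_presentationD[OF assms(1) presT]
  note \<tau>_sup = generated_congruence_superset[of ?T M ?G]
  note \<tau>_trans = act_congruence_trans[OF G(2)] and \<tau>_sym = act_congruence_sym[OF G(2)]
    and \<tau>_refl = act_congruence_refl[OF G(2)] and \<tau>_act = act_congruence_act[OF G(2)]

  have None_Z: "None \<in> ?Z" and Some_Z: "Some x \<in> ?Z \<longleftrightarrow> x \<in> X - B" for x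
    by (auto simp: zero_gens_def)
  have zeros: "((None, m), (None, n)) \<in> ?\<tau>" if mn: "m \<in> carrier M" "n \<in> carrier M" for m n
  proof -
    let ?N = "free_act M {None :: 'a option}"
    \<comment> \<open>Here \<open>id\<close> is the inclusion of the free act on \<open>None\<close>
      into \<open>?G\<close>. It transports the collapse caused by \<open>S\<close> alone to the
      larger set of relations.\<close>
    have "(id (None, m), id (None, n)) \<in> ?\<tau>"
    proof (rule generated_congruence_map[where A = ?N and R = S and f = id, OF _ G(2)])
      show "right_act M ?N" by (rule right_act_free[OF assms(1)]) simp
      show "((None, m), (None, n)) \<in> generated_congruence M ?N S"
        using mn by (intro defined_by_trivial_act[OF assms(7)]) (auto simp: carrier_free_act)
      show "S \<subseteq> carrier ?N \<times> carrier ?N"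
        using presS unfolding act_presentation_def by blast
      show "id u \<in> carrier ?G" if "u \<in> carrier ?N" for u
        using that None_Z by (auto simp: carrier_free_act)
      show "(id (u \<cdot>\<^bsub>?N\<^esub> k), id u \<cdot>\<^bsub>?G\<^esub> k) \<in> ?\<tau>"
        if "u \<in> carrier ?N" "k \<in> carrier M" for u k
        using that None_Z by (auto simp: carrier_free_act act_free_act intro!: \<tau>_refl)
      show "(id u, id v) \<in> ?\<tau>" if "(u, v) \<in> S" for u v
        using that \<tau>_sup by auto
    qed
    then show ?thesis by simp
  qed

  \<comment> \<open>The map from words over \<open>X\<close> to words over the new
    generators\<close>
  define f :: "'a \<times> 'm \<Rightarrow> 'a option \<times> 'm"
    where "f u = (if fst u \<in> B then ?zero else lift_word u)" for u
  have f_B: "f (x, m) = ?zero" if "x \<in> B" for x m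
    using that by (simp add: f_def)
  have f_notB: "f (x, m) = (Some x, m)" if "x \<notin> B" for x m
    using that by (simp add: f_def lift_word_def)
  have f_car: "f u \<in> carrier ?G" if "u \<in> carrier ?F" for u
    using that by (auto simp: f_def carrier_free_act zero_gens_def free_gen_def lift_word_def)
  \<comment> \<open>For a generator in \<open>B\<close> the two sides are \<open>0\<close> and
    \<open>0 \<cdot> n\<close>: distinct words in general, but identified by
    \<open>zeros\<close>.\<close>
  have f_act: "(f (u \<cdot>\<^bsub>?F\<^esub> n), f u \<cdot>\<^bsub>?G\<^esub> n) \<in> ?\<tau>"
    if u: "u \<in> carrier ?F" and n: "n \<in> carrier M" for u n
  proof (cases "fst u \<in> B")
    case True
    then show ?thesis using zeros n u
      by (cases u) (auto simp: f_def act_free_act free_gen_def)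
  next
    case False
    then show ?thesis using n u
      by (cases u) (auto simp: f_notB act_free_act carrier_free_act Some_Z intro!: \<tau>_refl)
  qed
  \<comment> \<open>\<open>R_two\<close> supplies this when the generator of \<open>u\<close> is
    outside \<open>B\<close>; otherwise \<open>f\<close> has already replaced \<open>u\<close> by
    \<open>0\<close>. The word \<open>v\<close> ranges over \<open>X \<union> Y\<close> because it
    may be a generator from \<open>Y\<close>.\<close>
  have f_zero: "(f u, ?zero) \<in> ?\<tau>"
    if u: "u \<in> carrier ?F" "fst u \<cdot>\<^bsub>A\<^esub> snd u \<in> B" and v: "v \<in> carrier (free_act M (X \<union> Y))"
      "(u, v) \<in> R_ext M R Y w \<union> (R_ext M R Y w)\<inverse>" for u v
  proof (cases "fst u \<in> B")
    case True
    then show ?thesis using zeros by (auto simp: f_def free_gen_def)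
  next
    case False
    then have "u \<in> carrier (free_act M (X - B)) \<inter> L_words M A X B"
      using u by (auto simp: L_words_def represents_def carrier_free_act)
    with v have "(lift_word u, ?zero) \<in> R_two M A X B Y R w"
      unfolding R_two_def by blast
    then show ?thesis using False \<tau>_sup by (auto simp: f_def)
  qed
  have f_R: "(f u, f v) \<in> ?\<tau>" if "(u, v) \<in> R" for u v
  proof -
    have uv: "u \<in> carrier ?F" "v \<in> carrier ?F"
      "fst u \<cdot>\<^bsub>A\<^esub> snd u = fst v \<cdot>\<^bsub>A\<^esub> snd v"
      using that RF R_eq[of "fst u" "snd u" "fst v" "snd v"] by auto
    show ?thesis
    proof (cases "fst u \<cdot>\<^bsub>A\<^esub> snd u \<in> B")
      \<comment> \<open>A relation inside \<open>B\<close> is not kept as such. Each of its two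
        sides is sent to \<open>0\<close> separately, the right one by means of the converse of
        \<open>R_ext\<close>.\<close>
      case True
      have "(f u, ?zero) \<in> ?\<tau>"
        by (rule f_zero[where v = v])
          (use True uv that in \<open>auto simp: carrier_free_act R_ext_def\<close>)
      moreover have "(f v, ?zero) \<in> ?\<tau>"
        by (rule f_zero[where v = u])
          (use True uv that in \<open>auto simp: carrier_free_act R_ext_def\<close>)
      ultimately show ?thesis using \<tau>_trans \<tau>_sym by blast
    next
      case False
      then have nB: "fst u \<notin> B" "fst v \<notin> B"
        using uv subact_closed[OF assms(5), of "fst u" "snd u"]
          subact_closed[OF assms(5), of "fst v" "snd v"]
        by (auto simp: carrier_free_act)
      have "fst u \<cdot>\<^bsub>A\<^esub> snd u \<in> carrier A - B"
        using False uv XA act_closed by (auto simp: carrier_free_act)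
      then have "(lift_word u, lift_word v) \<in> R_one A B R"
        using that unfolding R_one_def represents_def by blast
      then show ?thesis using nB \<tau>_sup by (auto simp: f_def)
    qed
  qed
  have f_\<rho>: "(f u, f v) \<in> ?\<tau>" if "(u, v) \<in> ?\<rho>" for u v
    by (rule generated_congruence_map[OF F(1) G(2) f_car f_act RF f_R that])

  \<comment> \<open>Words that represent elements of \<open>B\<close>\<close>
  have f_L: "(f u, ?zero) \<in> ?\<tau>" if u: "u \<in> carrier ?F" "fst u \<cdot>\<^bsub>A\<^esub> snd u \<in> B" for u
  proof -
    obtain y n where y: "y \<in> Y" "n \<in> carrier M" "fst u \<cdot>\<^bsub>A\<^esub> snd u = y \<cdot>\<^bsub>A\<^esub> n"
      using assms(6) u(2) unfolding act_generates_def by auto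
    have yB: "y \<in> B" using assms(6) y(1) unfolding act_generates_def by auto
    obtain x m where wy: "w y = (x, m)" "x \<in> X" "m \<in> carrier M" "x \<cdot>\<^bsub>A\<^esub> m = y"
      using assms(8) y(1) unfolding represents_def carrier_free_act by fastforce
    \<comment> \<open>Both words represent \<open>y\<close> acted on by \<open>n\<close>, so this is
      the kernel description of \<rho>. It reduces an arbitrary word for an element of
      \<open>B\<close> to the chosen words \<open>w y\<close>.\<close>
    have "(u, w y \<cdot>\<^bsub>?F\<^esub> n) \<in> ?\<rho>"
      using u y wy XA act_assoc by (subst ker_R) (auto simp: act_free_act carrier_free_act)
    then have "(f u, f (w y \<cdot>\<^bsub>?F\<^esub> n)) \<in> ?\<tau>" by (rule f_\<rho>)
    moreover have "(f (w y \<cdot>\<^bsub>?F\<^esub> n), f (w y) \<cdot>\<^bsub>?G\<^esub> n) \<in> ?\<tau>"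
      using wy y by (intro f_act) (auto simp: carrier_free_act)
    \<comment> \<open>The added relation \<open>y = w y\<close>, read from right to left, is what
      puts \<open>w y\<close> within reach of \<open>R_two\<close>.\<close>
    moreover have "(f (w y), ?zero) \<in> ?\<tau>"
      by (rule f_zero[where v = "free_gen M y"])
        (use y wy yB in \<open>auto simp: carrier_free_act R_ext_def free_gen_def\<close>)
    then have "(f (w y) \<cdot>\<^bsub>?G\<^esub> n, ?zero \<cdot>\<^bsub>?G\<^esub> n) \<in> ?\<tau>"
      using y(2) by (rule \<tau>_act)
    moreover have "(?zero \<cdot>\<^bsub>?G\<^esub> n, ?zero) \<in> ?\<tau>"
      using y(2) zeros by (auto simp: free_gen_def act_free_act)
    ultimately show ?thesis using \<tau>_trans by blast
  qed

  \<comment> \<open>Evaluation in the Rees quotient and soundness of the relations\<close>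
  have Q: "right_act M ?Q"
    unfolding rees_quotient_def
    using right_act_quotient act_congruence_rees assms(2,5) by blast
  note rees_act = act_rees_quotient[OF assms(2,5)]
  let ?e = "eval_word ?Q ?\<iota>"
  have e_Some: "?e (Some x, m) = (if x \<cdot>\<^bsub>A\<^esub> m \<in> B then B else {x \<cdot>\<^bsub>A\<^esub> m})"
    if "x \<in> X - B" "m \<in> carrier M" for x m
    using that XA rees_act(1) by (auto simp: eval_word_def)
  have e_None: "?e (None, m) = B" if "m \<in> carrier M" for m
    using that rees_act(2) by (simp add: eval_word_def)
  have car_Q: "C \<in> carrier ?Q \<longleftrightarrow> C = B \<or> (\<exists>a\<in>carrier A - B. C = {a})" for C
  proof -
    obtain b where b: "b \<in> B" using assms(5) unfolding subact_def by blast
    have "carrier ?Q = (\<lambda>a. if a \<in> B then B else {a}) ` carrier A"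
      using rees_class[OF assms(5)]
      by (simp add: rees_quotient_def carrier_quotient_act)
    then show ?thesis using b BA by (auto simp: image_iff)
  qed
  have \<iota>_car: "?\<iota> z \<in> carrier ?Q" if "z \<in> ?Z" for z
    using that XA by (auto simp: car_Q zero_gens_def)
  have e_car: "?e u \<in> carrier ?Q" if "u \<in> carrier ?G" for u
    using that \<iota>_car right_act.act_closed[OF Q] by (auto simp: carrier_free_act eval_word_def)

  \<comment> \<open>The sides of an \<open>R_one\<close> relation already agree in \<open>A\<close>;
    those of \<open>R_two\<close> and \<open>S\<close> relations all evaluate to the class
    \<open>B\<close>.\<close>
  have e_T: "?e u = ?e v" if uv: "(u, v) \<in> ?T" for u v
  proof -
    consider "(u, v) \<in> R_one A B R" | "(u, v) \<in> R_two M A X B Y R w" | "(u, v) \<in> S"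
      using uv by blast
    then show ?thesis
    proof cases
      case 1
      then obtain x m y n where p: "u = (Some x, m)" "v = (Some y, n)" "((x, m), (y, n)) \<in> R"
        unfolding R_one_def by (auto simp: lift_word_def)
      moreover have "x \<in> X - B" "y \<in> X - B" "m \<in> carrier M" "n \<in> carrier M"
        using 1 R_one_car p by (auto simp: carrier_free_act zero_gens_def)
      ultimately show ?thesis using R_eq[OF p(3)] by (simp add: e_Some)
    next
      case 2
      then obtain x m where "u = (Some x, m)" "v = (None, \<one>\<^bsub>M\<^esub>)" "x \<in> X - B" "m \<in> carrier M"
        "x \<cdot>\<^bsub>A\<^esub> m \<in> B"
        unfolding R_two_def L_words_def represents_def
        by (auto simp: carrier_free_act lift_word_def free_gen_def)
      then show ?thesis by (simp add: e_Some e_None)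
    next
      case 3
      then have "u \<in> {None} \<times> carrier M" "v \<in> {None} \<times> carrier M"
        using presS by (auto simp: act_presentation_def carrier_free_act)
      then show ?thesis by (auto simp: e_None)
    qed
  qed
  have e_act: "?e (u \<cdot>\<^bsub>?G\<^esub> n) = ?e u \<cdot>\<^bsub>?Q\<^esub> n" if "u \<in> carrier ?G" "n \<in> carrier M" for u n
    using that \<iota>_car right_act.act_assoc[OF Q]
    by (auto simp: carrier_free_act act_free_act eval_word_def)
  have sound: "?e u = ?e v" if "(u, v) \<in> ?\<tau>" for u v
  proof -
    \<comment> \<open>Equality on \<open>?Q\<close> is taken as the target congruence, so that
      respecting the relations in \<open>?T\<close> means evaluating their sides equally.\<close>
    have "(?e u, ?e v) \<in> Id_on (carrier ?Q)"
    proof (rule generated_congruence_map[OF G(1) act_congruence_equality[OF Q] e_car _ TG _ that])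
      show "(?e (a \<cdot>\<^bsub>?G\<^esub> m), ?e a \<cdot>\<^bsub>?Q\<^esub> m) \<in> Id_on (carrier ?Q)"
        if "a \<in> carrier ?G" "m \<in> carrier M" for a m
        using e_act[OF that] right_act.act_closed[OF Q e_car[OF that(1)] that(2)]
        by (simp add: Id_on_iff)
      show "(?e a, ?e b) \<in> Id_on (carrier ?Q)" if "(a, b) \<in> ?T" for a b
      proof -
        have "a \<in> carrier ?G" using that TG by blast
        then show ?thesis using e_T[OF that] e_car[of a] by (simp add: Id_on_iff)
      qed
    qed
    then show ?thesis by auto
  qed

  \<comment> \<open>Completeness: words with equal value are related\<close>
  have to_zero: "(u, ?zero) \<in> ?\<tau>" if u: "u \<in> carrier ?G" "?e u = B" for u
  proof -
    consider m where "u = (None, m)" "m \<in> carrier M"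
      | x m where "u = (Some x, m)" "x \<in> X - B" "m \<in> carrier M"
      using u(1) by (auto simp: carrier_free_act zero_gens_def)
    then show ?thesis
    proof cases
      case 1
      then show ?thesis using zeros by (simp add: free_gen_def)
    next
      case 2
      \<comment> \<open>\<open>B\<close> may itself be a singleton, but a singleton class equal to
        \<open>B\<close> still has its element in \<open>B\<close>, so both branches of
        \<open>e_Some\<close> agree.\<close>
      then have "x \<cdot>\<^bsub>A\<^esub> m \<in> B"
        using u(2) by (auto simp: e_Some split: if_splits)
      then show ?thesis
        using f_L[of "(x, m)"] 2 by (simp add: f_notB carrier_free_act)
    qed
  qed
  have complete: "(u, v) \<in> ?\<tau>" if uv: "u \<in> carrier ?G" "v \<in> carrier ?G" "?e u = ?e v" for u v
  proof (cases "?e u = B")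
    case True
    then show ?thesis using to_zero[of u] to_zero[of v] uv \<tau>_trans \<tau>_sym by metis
  next
    case False
    have Some_form: "\<exists>x m. t = (Some x, m) \<and> x \<in> X - B \<and> m \<in> carrier M \<and> ?e t = {x \<cdot>\<^bsub>A\<^esub> m}"
      if "t \<in> carrier ?G" "?e t \<noteq> B" for t
      using that by (auto simp: carrier_free_act zero_gens_def e_None e_Some split: if_splits)
    obtain x m where u: "u = (Some x, m)" "x \<in> X - B" "m \<in> carrier M" "?e u = {x \<cdot>\<^bsub>A\<^esub> m}"
      using Some_form[OF uv(1) False] by blast
    obtain y n where v: "v = (Some y, n)" "y \<in> X - B" "n \<in> carrier M" "?e v = {y \<cdot>\<^bsub>A\<^esub> n}"
      using Some_form[OF uv(2)] uv(3) False by auto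
    have "x \<cdot>\<^bsub>A\<^esub> m = y \<cdot>\<^bsub>A\<^esub> n"
      using u(4) v(4) uv(3) by simp
    \<comment> \<open>Both words come from words over \<open>X\<close> with equal value in
      \<open>A\<close>, hence \<rho>-related. As \<open>x\<close> and \<open>y\<close> lie outside
      \<open>B\<close>, \<open>f\<close> returns exactly \<open>u\<close> and
      \<open>v\<close>.\<close>
    with u v show ?thesis
      using f_\<rho>[of "(x, m)" "(y, n)"] ker_R[of "(x, m)" "(y, n)"]
      by (simp add: f_notB carrier_free_act)
  qed

  \<comment> \<open>Generation of the quotient, and the conclusion\<close>
  show ?thesis
  proof (rule defined_by_viaI[OF Q presT])
    show "act_generates M ?Q (?\<iota> ` ?Z)"
      unfolding act_generates_def
    proof (intro conjI ballI)
      show "?\<iota> ` ?Z \<subseteq> carrier ?Q" using \<iota>_car by blast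
      fix C assume "C \<in> carrier ?Q"
      then consider "C = B" | a where "a \<in> carrier A - B" "C = {a}"
        using car_Q by blast
      then have "\<exists>u\<in>carrier ?G. C = ?e u"
      proof cases
        case 1
        then show ?thesis
          using e_None[OF one_closed]
          by (intro bexI[of _ "(None, \<one>\<^bsub>M\<^esub>)"]) (auto simp: carrier_free_act zero_gens_def)
      next
        case 2
        then obtain x m where xm: "x \<in> X" "m \<in> carrier M" "a = x \<cdot>\<^bsub>A\<^esub> m"
          using assms(3) unfolding act_generates_def by blast
        \<comment> \<open>Any word for an element outside \<open>B\<close> has its generator outside
          \<open>B\<close>, so discarding the generators in \<open>B\<close> loses no such
          element.\<close>
        then have "x \<notin> B" using 2 subact_closed[OF assms(5)] by auto
        then show ?thesis using 2 xm
          by (intro bexI[of _ "(Some x, m)"]) (auto simp: e_Some carrier_free_act zero_gens_def)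
      qed
      then show "\<exists>z\<in>?\<iota> ` ?Z. \<exists>m\<in>carrier M. C = z \<cdot>\<^bsub>?Q\<^esub> m"
        by (auto simp: carrier_free_act eval_word_def)
    qed
  qed (use sound complete in blast)
qed

end
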